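(* All the solutions of $f(z)=b$ have the form $z=g_{0,0}=0$ or $$z=g_{\sigma,m}=a^m\bigl(P_{\sigma_1}^{-1}(b)-b\bigr)\prod_{n=2}^{\infty}\frac{a}{Q\bigl(P^{-1}_{\sigma_n}\circ\cdots\circ P^{-1}_{\sigma_1}(b)\bigr)},\qquad m\in\mathbb{N}\cup\{0\},\ \ \sigma\in\Sigma',$$ where $\Sigma'=\{\sigma\in\Sigma:\ \sigma_1\ne 0\}$.
   Context: Let $P$ be a complex polynomial of degree $d\ge 2$ and let $b\in\mathbb{C}$, $b\ne 0$, be a repelling fixed point of $P$: $P(b)=b$ and $|a|>1$, where $a:=P'(b)$. Let $f$ be the entire solution of $f(az)=P(f(z))$ ($z\in\mathbb{C}$) with $f(0)=b$, $f'(0)=1$; it can be taken as $f(z)=\lim_{n\to\infty}P^{\circ n}(b+a^{-n}z)$, the convergence being uniform on compact sets. Branches of $P^{-1}$: fix functions $P_0^{-1},\dots,P_{d-1}^{-1}:\mathbb{C}\to\mathbb{C}$ such that for every $w\in\mathbb{C}$ the values $P_0^{-1}(w),\dots,P_{d-1}^{-1}(w)$ form a complete set of solutions $z$ of $P(z)=w$, counted with multiplicity. The principal branch $P_0^{-1}$ satisfies $P_0^{-1}(b)=b$ and is analytic in some open neighbourhood of $b$; otherwise the numbering of the branches is arbitrary. Standing assumption (Hypothesis 1): for every $w\in\mathbb{C}$, the $n$-fold iterate $(P_0^{-1})^{\circ n}(w)\to b$ as $n\to\infty$. $Q$ is the polynomial $Q(z):=\frac{P(z)-b}{z-b}$. With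 $\mathbb{N}=\{1,2,\dots\}$, $$\Sigma=\{\sigma:\mathbb{N}\to\{0,\dots,d-1\}:\ \lim_{n\to\infty}\sigma_n=0\},$$ i.e. sequences which are eventually $0$. The symbol $g_{0,0}$ is just a name for the solution $z=0$. *)

theory Defs
  imports "HOL-Analysis.Analysis" "HOL-Computational_Algebra.Polynomial"
begin

text \<open>The equality of multisets says that the values of the branches at \<open>w\<close> are the solutions of
  \<open>P(z) = w\<close>, each listed as often as its multiplicity.\<close>

definition inverse_branches :: "complex poly \<Rightarrow> (nat \<Rightarrow> complex \<Rightarrow> complex) \<Rightarrow> bool" where
  "inverse_branches P Pinv \<longleftrightarrow>
     (\<forall>w. image_mset (\<lambda>i. Pinv i w) (mset_set {0..<degree P}) = proots (P - [:w:]))"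

definition principal_branch_at :: "complex \<Rightarrow> (complex \<Rightarrow> complex) \<Rightarrow> bool" where
  "principal_branch_at b p0 \<longleftrightarrow>
     p0 b = b \<and> (\<exists>U. open U \<and> b \<in> U \<and> p0 analytic_on U)"

text \<open>The polynomial \<open>(P(z) - b) / (z - b)\<close>; the division is exact when \<open>P(b) = b\<close>.\<close>

definition Qpoly :: "complex poly \<Rightarrow> complex \<Rightarrow> complex poly" where
  "Qpoly P b = (P - [:b:]) div [:- b, 1:]"

text \<open>Sequences are indexed from 1: the value \<open>\<sigma> 0\<close> is unconstrained and is never used below.
  The limit is taken in the discrete space \<open>nat\<close>, so \<open>\<sigma>\<close> is eventually 0.\<close>

definition Sigma_seqs :: "nat \<Rightarrow> (nat \<Rightarrow> nat) set" where
  "Sigma_seqs d = {\<sigma>. (\<forall>n\<ge>1. \<sigma> n \<in> {0..<d}) \<and> \<sigma> \<longlonglongrightarrow> 0}"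

definition Sigma_seqs' :: "nat \<Rightarrow> (nat \<Rightarrow> nat) set" where
  "Sigma_seqs' d = {\<sigma> \<in> Sigma_seqs d. \<sigma> 1 \<noteq> 0}"

text \<open>\<open>branch_comp Pinv \<sigma> n\<close> is \<open>Pinv (\<sigma> n) \<circ> \<dots> \<circ> Pinv (\<sigma> 1)\<close>.\<close>

fun branch_comp :: "(nat \<Rightarrow> complex \<Rightarrow> complex) \<Rightarrow> (nat \<Rightarrow> nat) \<Rightarrow> nat \<Rightarrow> complex \<Rightarrow> complex" where
  "branch_comp Pinv \<sigma> 0 = id"
| "branch_comp Pinv \<sigma> (Suc n) = Pinv (\<sigma> (Suc n)) \<circ> branch_comp Pinv \<sigma> n"

definition g_factor ::
  "complex poly \<Rightarrow> complex \<Rightarrow> (nat \<Rightarrow> complex \<Rightarrow> complex) \<Rightarrow> (nat \<Rightarrow> nat) \<Rightarrow> nat \<Rightarrow> complex" where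
  "g_factor P b Pinv \<sigma> n = poly (pderiv P) b / poly (Qpoly P b) (branch_comp Pinv \<sigma> n b)"

text \<open>The infinite product over \<open>n \<ge> 2\<close> is re-indexed to start at 0.\<close>

definition g_sol ::
  "complex poly \<Rightarrow> complex \<Rightarrow> (nat \<Rightarrow> complex \<Rightarrow> complex) \<Rightarrow> (nat \<Rightarrow> nat) \<Rightarrow> nat \<Rightarrow> complex" where
  "g_sol P b Pinv \<sigma> m =
     poly (pderiv P) b ^ m * (Pinv (\<sigma> 1) b - b) * (\<Prod>n. g_factor P b Pinv \<sigma> (n + 2))"

end

theory Submission
  imports Defs "HOL-Complex_Analysis.Conformal_Mappings"
begin

text \<open>A solution \<open>z \<noteq> 0\<close> of \<open>f z = b\<close> is recorded by the backward orbit \<open>w n = f (z / a ^ (m + n))\<close> of \<open>b\<close>,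
  where \<open>m\<close> is the last index with \<open>f (z / a ^ m) = b\<close>. Since \<open>w\<close> converges to \<open>b\<close> and the principal
  branch is continuous at \<open>b\<close>, the orbit eventually follows the principal branch, which gives the
  itinerary \<open>\<sigma>\<close>. As \<open>w n - b = (w (n + 1) - b) Q(w (n + 1))\<close>, the partial products telescope to
  \<open>a ^ n (w (n + 1) - b)\<close>, and \<open>f' 0 = 1\<close> makes them converge to \<open>z / a ^ (m + 1)\<close>. Every
  such orbit approaches \<open>b\<close> geometrically, whence the convergence of the products.\<close>

section \<open>The quotient polynomial of P - b by z - b\<close>

lemma poly_Qpoly_mult:
  assumes "poly P b = b"
  shows "(z - b) * poly (Qpoly P b) z = poly P z - b"
proof -
  have "[:- b, 1:] dvd P - [:b:]"
    using assms by (simp add: poly_eq_0_iff_dvd [symmetric])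
  then have "[:- b, 1:] * Qpoly P b = P - [:b:]"
    unfolding Qpoly_def by (rule dvd_mult_div_cancel)
  then have "poly ([:- b, 1:] * Qpoly P b) z = poly (P - [:b:]) z"
    by simp
  then show ?thesis
    by (simp add: algebra_simps)
qed

text \<open>Differentiate (z - b) Q(z) = P(z) - b and evaluate at b. This makes the factors a / Q(w)
  tend to 1 as w tends to b.\<close>

lemma poly_Qpoly_fixed_point:
  assumes "poly P b = b"
  shows "poly (Qpoly P b) b = poly (pderiv P) b"
proof -
  have "[:- b, 1:] dvd P - [:b:]"
    using assms by (simp add: poly_eq_0_iff_dvd [symmetric])
  then have "[:- b, 1:] * Qpoly P b = P - [:b:]"
    unfolding Qpoly_def by (rule dvd_mult_div_cancel)
  then have "pderiv ([:- b, 1:] * Qpoly P b) = pderiv (P - [:b:])"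
    by (rule arg_cong)
  then have "[:- b, 1:] * pderiv (Qpoly P b) + Qpoly P b = pderiv P"
    by (simp only: pderiv_mult pderiv_diff) (simp add: pderiv_pCons)
  then have "poly ([:- b, 1:] * pderiv (Qpoly P b) + Qpoly P b) b = poly (pderiv P) b"
    by (rule arg_cong)
  then show ?thesis
    by (simp only: poly_add poly_mult) simp
qed

section \<open>Values of the inverse branches\<close>

lemma inverse_branches_iff:
  assumes "inverse_branches P Pinv" "degree P > 0"
  shows "poly P z = w \<longleftrightarrow> (\<exists>i<degree P. Pinv i w = z)"
proof -
  have "P - [:w:] \<noteq> 0"
    using assms(2) by auto
  then have "set_mset (proots (P - [:w:])) = {z. poly P z = w}"
    by simp
  moreover have "set_mset (proots (P - [:w:])) = (\<lambda>i. Pinv i w) ` {0..<degree P}"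
    using assms(1) unfolding inverse_branches_def by (metis finite_atLeastLessThan finite_set_mset_mset_set set_image_mset)
  ultimately have "z \<in> {z. poly P z = w} \<longleftrightarrow> z \<in> (\<lambda>i. Pinv i w) ` {0..<degree P}"
    by simp
  then show ?thesis
    by auto
qed

text \<open>The derivative of P at b is nonzero, so b is a simple root of \<open>P - [:b:]\<close>;
  a second branch with value b there would give it multiplicity at least 2 in
  \<open>proots\<close>.\<close>

lemma nonprincipal_branch_neq:
  assumes "inverse_branches P Pinv" "poly P b = b" "poly (pderiv P) b \<noteq> 0"
    and "Pinv 0 b = b" "0 < i" "i < degree P"
  shows "Pinv i b \<noteq> b"
proof
  assume i: "Pinv i b = b"
  let ?p = "P - [:b:]"
  have nz: "?p \<noteq> 0" 
    using assms(6) by auto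
  have "order b (pderiv P) = 0"
    using assms(3) order_root by blast
  then have "order b ?p = 1"
    using order_pderiv [OF nz, of b] assms(2) by (simp add: pderiv_diff pderiv_pCons)
  moreover have "count (proots ?p) b \<ge> 2"
  proof -
    have "mset_set {0, i} \<subseteq># mset_set {0..<degree P}"
      using assms by (intro subset_imp_msubset_mset_set) auto
    then have "image_mset (\<lambda>i. Pinv i b) (mset_set {0, i}) \<subseteq># proots ?p"
      using assms(1) unfolding inverse_branches_def by (metis image_mset_subseteq_mono)
    moreover have "image_mset (\<lambda>i. Pinv i b) (mset_set {0, i}) = {#b, b#}"
      using assms i by simp
    ultimately show ?thesis
      using mset_subset_eq_count [of "{#b, b#}" "proots ?p" b] by simp
  qed
  ultimately show False
    using nz by simp
qed

section \<open>Products along backward orbits\<close>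

lemma backward_orbit_prod:
  fixes w :: "nat \<Rightarrow> complex"
  assumes "poly P b = b" "\<And>n. poly P (w (Suc n)) = w n" "\<And>n. w n \<noteq> b"
  shows "poly (Qpoly P b) (w (Suc n)) \<noteq> 0"
    and "(w 0 - b) * (\<Prod>i<n. a / poly (Qpoly P b) (w (Suc i))) = a ^ n * (w n - b)"
proof -
  have step: "(w (Suc n) - b) * poly (Qpoly P b) (w (Suc n)) = w n - b" for n
    using poly_Qpoly_mult [OF assms(1)] assms(2) by simp
  show nz: "poly (Qpoly P b) (w (Suc n)) \<noteq> 0" for n
    using step [of n] assms(3) [of n] by auto
  show "(w 0 - b) * (\<Prod>i<n. a / poly (Qpoly P b) (w (Suc i))) = a ^ n * (w n - b)"
  proof (induction n)
    case (Suc n)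
    have "a ^ n * (w n - b) * (a / poly (Qpoly P b) (w (Suc n))) = a ^ Suc n * (w (Suc n) - b)"
      using nz [of n] by (simp add: step [of n, symmetric])
    with Suc show ?case
      by (simp add: mult.assoc [symmetric])
  qed simp
qed

text \<open>Near b each backward step divides the distance to b by |Q|, which is close to |a| > 1,
  so the distances are summable. As Q - a vanishes at b, the deviation of a / Q from 1 is bounded by
  a constant times the distance, and the product converges absolutely.\<close>

lemma backward_orbit_convergent_prod:
  fixes w :: "nat \<Rightarrow> complex"
  assumes "poly P b = b" "\<And>n. poly P (w (Suc n)) = w n"
    and "w \<longlonglongrightarrow> b" "norm (poly (pderiv P) b) > 1"
  shows "convergent_prod (\<lambda>n. poly (pderiv P) b / poly (Qpoly P b) (w (Suc n)))"
proof -
  define a where "a = poly (pderiv P) b"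
  define q where "q = (\<lambda>n. poly (Qpoly P b) (w (Suc n)))"
  have w: "(\<lambda>n. w (Suc n)) \<longlonglongrightarrow> b"
    using assms(3) by (rule LIMSEQ_Suc)
  have Qb: "poly (Qpoly P b) b = a"
    using poly_Qpoly_fixed_point [OF assms(1)] by (simp add: a_def)
  have q: "q \<longlonglongrightarrow> a"
    unfolding q_def using tendsto_poly [OF w, of "Qpoly P b"] by (simp add: Qb)
  have a: "norm a > 1" "a \<noteq> 0"
    using assms(4) by (auto simp: a_def)
  have step: "(w (Suc n) - b) * q n = w n - b" for n
    using poly_Qpoly_mult [OF assms(1)] assms(2) by (simp add: q_def)
  \<comment> \<open>Any number strictly between 1 and |a| would do: eventually |q n| > c, which
    gives the ratio 1 / c < 1.\<close>
  define c where "c = (1 + norm a) / 2"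
  have c: "1 < c" "c < norm a"
    using a by (auto simp: c_def)
  have "\<forall>\<^sub>F n in sequentially. norm (q n) > c"
    using order_tendstoD(1) [OF tendsto_norm [OF q] c(2)] .
  then obtain N where N: "\<And>n. n \<ge> N \<Longrightarrow> norm (q n) > c"
    by (auto simp: eventually_sequentially)
  have sum_w: "summable (\<lambda>n. norm (w n - b))"
  proof (rule summable_ratio_test)
    show "1 / c < 1"
      using c by simp
    fix n assume "n \<ge> N"
    then have "norm (w (Suc n) - b) * c \<le> norm (w (Suc n) - b) * norm (q n)"
      using N by (intro mult_left_mono) (auto intro: less_imp_le)
    also have "\<dots> = norm (w n - b)"
      by (simp add: step [of n, symmetric] norm_mult)
    finally show "norm (norm (w (Suc n) - b)) \<le> 1 / c * norm (norm (w n - b))"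
      using c by (simp add: field_simps)
  qed
  \<comment> \<open>Factoring out z - b a second time exhibits the linear bound on
    \<open>q n - a\<close>; the cofactor R stays bounded along the convergent orbit.\<close>
  obtain R where R: "Qpoly P b - [:a:] = [:- b, 1:] * R"
  proof -
    have "[:- b, 1:] dvd Qpoly P b - [:a:]"
      using Qb by (simp add: poly_eq_0_iff_dvd [symmetric])
    then show ?thesis
      using that by (rule dvdE)
  qed
  have q_eq: "q n - a = (w (Suc n) - b) * poly R (w (Suc n))" for n
  proof -
    have "poly (Qpoly P b - [:a:]) (w (Suc n)) = poly ([:- b, 1:] * R) (w (Suc n))"
      by (simp only: R)
    then show ?thesis
      by (simp add: q_def algebra_simps)
  qed
  have "(\<lambda>n. poly R (w (Suc n))) \<longlonglongrightarrow> poly R b"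
    by (intro tendsto_poly w)
  then have "Bseq (\<lambda>n. poly R (w (Suc n)))"
    by (intro convergent_imp_Bseq convergentI)
  then obtain K where K: "K > 0" "\<And>n. norm (poly R (w (Suc n))) \<le> K"
    by (auto simp: Bseq_def)
  have "summable (\<lambda>n. norm (a / q n - 1))"
  proof (rule summable_comparison_test')
    show "summable (\<lambda>n. K * norm (w (Suc n) - b))"
      using sum_w summable_Suc_iff [of "\<lambda>n. norm (w n - b)"] by (intro summable_mult) simp
    fix n assume "n \<ge> N"
    then have n: "norm (q n) > 1" "q n \<noteq> 0"
      using N [of n] c by auto
    then have "norm (a / q n - 1) = norm (q n - a) / norm (q n)"
      by (simp add: norm_divide [symmetric] diff_divide_distrib norm_minus_commute)
    also have "\<dots> \<le> norm (q n - a)"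
      using n by (simp add: divide_le_eq mult_le_cancel_left1)
    also have "\<dots> \<le> K * norm (w (Suc n) - b)"
      using K(2) [of n] by (simp add: q_eq norm_mult mult.commute [of K] mult_left_mono)
    finally show "norm (norm (a / q n - 1)) \<le> K * norm (w (Suc n) - b)"
      by simp
  qed
  then show ?thesis
    unfolding a_def q_def
    by (intro abs_convergent_prod_imp_convergent_prod summable_imp_abs_convergent_prod)
qed

section \<open>Itineraries and backward orbits\<close>

lemma backward_orbit_branch_comp:
  assumes "\<And>n. Pinv (\<sigma> (Suc n)) (w n) = w (Suc n)"
  shows "branch_comp Pinv \<sigma> n (w 0) = w n"
  by (induction n) (auto simp: assms)

lemma branch_comp_eventually_principal:
  assumes "\<And>n. n \<ge> N \<Longrightarrow> \<sigma> n = 0"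
  shows "branch_comp Pinv \<sigma> (k + N) x = (Pinv 0 ^^ k) (branch_comp Pinv \<sigma> N x)"
  by (induction k) (auto simp: assms)

text \<open>The orbit leaves b at its first step because \<open>\<sigma> 1\<close> is nonzero, and
  it cannot return: b is fixed by P, so a later point equal to b would force its predecessor to be
  b. Once \<open>\<sigma>\<close> is 0, only the principal branch is iterated, and its iterates tend
  to b.\<close>

lemma Sigma_seqs'_branch_comp:
  assumes "inverse_branches P Pinv" "poly P b = b" "poly (pderiv P) b \<noteq> 0"
    and "Pinv 0 b = b" "\<And>w. (\<lambda>n. (Pinv 0 ^^ n) w) \<longlonglongrightarrow> b"
    and "\<sigma> \<in> Sigma_seqs' (degree P)" "degree P > 0"
  shows "poly P (branch_comp Pinv \<sigma> (Suc n) b) = branch_comp Pinv \<sigma> n b"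
    and "branch_comp Pinv \<sigma> (Suc n) b \<noteq> b"
    and "(\<lambda>n. branch_comp Pinv \<sigma> n b) \<longlonglongrightarrow> b"
proof -
  have \<sigma>: "\<And>n. n \<ge> 1 \<Longrightarrow> \<sigma> n < degree P" "\<sigma> \<longlonglongrightarrow> 0" "\<sigma> 1 \<noteq> 0"
    using assms(6) by (auto simp: Sigma_seqs'_def Sigma_seqs_def)
  show orbit: "poly P (branch_comp Pinv \<sigma> (Suc n) b) = branch_comp Pinv \<sigma> n b" for n
    using inverse_branches_iff [OF assms(1,7)] \<sigma>(1) [of "Suc n"] by auto
  show "branch_comp Pinv \<sigma> (Suc n) b \<noteq> b"
  proof (induction n)
    case 0
    show ?case
      using nonprincipal_branch_neq [OF assms(1-4), of "\<sigma> 1"] \<sigma> by simp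
  next
    case (Suc n)
    then show ?case
      using orbit [of "Suc n"] assms(2) by metis
  qed
  have "\<forall>\<^sub>F n in sequentially. \<sigma> n = 0"
    using \<sigma>(2) by (simp add: tendsto_discrete)
  then obtain N where "\<And>n. n \<ge> N \<Longrightarrow> \<sigma> n = 0"
    by (auto simp: eventually_sequentially)
  then have "(\<lambda>k. branch_comp Pinv \<sigma> (k + N) b) \<longlonglongrightarrow> b"
    using assms(5) by (simp add: branch_comp_eventually_principal)
  then show "(\<lambda>n. branch_comp Pinv \<sigma> n b) \<longlonglongrightarrow> b"
    by (rule LIMSEQ_offset)
qed

text \<open>For large n, both \<open>Pinv 0 (w n)\<close> and \<open>w (Suc n)\<close> are preimages
  of \<open>w n\<close> close to b; P is injective there, so they coincide.\<close>

lemma backward_orbit_itinerary: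
  assumes "inverse_branches P Pinv" "degree P > 0"
    and "poly P b = b" "poly (pderiv P) b \<noteq> 0" "principal_branch_at b (Pinv 0)"
    and "\<And>n. poly P (w (Suc n)) = w n" "w 0 = b" "w 1 \<noteq> b" "w \<longlonglongrightarrow> b"
  obtains \<sigma> where "\<sigma> \<in> Sigma_seqs' (degree P)" "\<And>n. branch_comp Pinv \<sigma> n b = w n"
proof -
  \<comment> \<open>Branches may share a value; taking the least index ensures that 0 is chosen
    whenever the principal branch fits. The entry \<open>\<sigma> 0\<close>, where
    \<open>n - 1\<close> truncates to 0, is a dummy.\<close>
  define \<sigma> where "\<sigma> n = (LEAST i. Pinv i (w (n - 1)) = w n)" for n
  have ex: "\<exists>i<degree P. Pinv i (w n) = w (Suc n)" for n
    using inverse_branches_iff [OF assms(1,2)] assms(6) by blast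
  have \<sigma>: "Pinv (\<sigma> (Suc n)) (w n) = w (Suc n)" "\<sigma> (Suc n) < degree P" for n
  proof -
    obtain i where i: "i < degree P" "Pinv i (w n) = w (Suc n)"
      using ex by blast
    show "Pinv (\<sigma> (Suc n)) (w n) = w (Suc n)"
      unfolding \<sigma>_def diff_Suc_1 by (rule LeastI) (rule i)
    have "\<sigma> (Suc n) \<le> i"
      unfolding \<sigma>_def diff_Suc_1 by (rule Least_le) (rule i)
    with i show "\<sigma> (Suc n) < degree P"
      by simp
  qed
  have p0: "Pinv 0 b = b" "isCont (Pinv 0) b"
    using assms(5) unfolding principal_branch_at_def
    by (blast intro: analytic_at_imp_isCont analytic_on_subset)+
  obtain r where r: "r > 0" "inj_on (poly P) (ball b r)"
  proof (rule has_complex_derivative_locally_injective [of "poly P" UNIV b])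
    show "deriv (poly P) b \<noteq> 0"
      using assms(4) DERIV_imp_deriv [OF poly_DERIV, of P b] by simp
  qed (auto intro: holomorphic_intros)
  have "(\<lambda>n. Pinv 0 (w n)) \<longlonglongrightarrow> b"
    using isCont_tendsto_compose [OF p0(2) assms(9)] p0(1) by simp
  then have "\<forall>\<^sub>F n in sequentially. Pinv 0 (w n) \<in> ball b r"
    using r(1) by (metis centre_in_ball open_ball topological_tendstoD)
  moreover have "\<forall>\<^sub>F n in sequentially. w (Suc n) \<in> ball b r"
    using r(1) LIMSEQ_Suc [OF assms(9)] by (metis centre_in_ball open_ball topological_tendstoD)
  ultimately have "\<forall>\<^sub>F n in sequentially. \<sigma> (Suc n) = 0"
  proof eventually_elim
    case (elim n)
    have "poly P (Pinv 0 (w n)) = w n"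
      using inverse_branches_iff [OF assms(1,2)] assms(2) by blast
    then have "Pinv 0 (w n) = w (Suc n)"
      using inj_onD [OF r(2), of "Pinv 0 (w n)" "w (Suc n)"] elim assms(6) [of n] by simp
    then show ?case
      unfolding \<sigma>_def by (intro Least_eq_0) simp
  qed
  then have "(\<lambda>n. \<sigma> (Suc n)) \<longlonglongrightarrow> 0"
    by (simp add: tendsto_discrete)
  then have lim: "\<sigma> \<longlonglongrightarrow> 0"
    by (rule LIMSEQ_imp_Suc)
  have "\<sigma> 1 \<noteq> 0"
    using \<sigma>(1) [of 0] assms(7,8) p0(1) by (metis One_nat_def)
  moreover have "\<sigma> n < degree P" if "n \<ge> 1" for n
    using \<sigma>(2) [of "n - 1"] that by simp
  ultimately have "\<sigma> \<in> Sigma_seqs' (degree P)"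
    using lim by (simp add: Sigma_seqs'_def Sigma_seqs_def)
  moreover have "branch_comp Pinv \<sigma> n b = w n" for n
    using backward_orbit_branch_comp [of Pinv \<sigma> w n, OF \<sigma>(1)] assms(7) by simp
  ultimately show ?thesis
    using that by blast
qed

section \<open>Scaling limit of f at 0\<close>

lemma LIMSEQ_divide_power_zero:
  fixes a z :: complex
  assumes "norm a > 1"
  shows "(\<lambda>n. z / a ^ n) \<longlonglongrightarrow> 0"
proof -
  have "norm (inverse a) < 1"
    using assms by (simp add: norm_inverse inverse_less_1_iff)
  then have "(\<lambda>n. z * inverse a ^ n) \<longlonglongrightarrow> z * 0"
    by (intro tendsto_intros LIMSEQ_power_zero)
  then show ?thesis
    by (simp add: divide_inverse power_inverse)
qed

text \<open>For nonzero z this is z times the difference quotient of f at 0 with increment z / a^n,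
  which tends to 0 without reaching it.\<close>

lemma DERIV_scaled_LIMSEQ:
  fixes f :: "complex \<Rightarrow> complex"
  assumes "(f has_field_derivative D) (at 0)" "norm a > 1"
  shows "(\<lambda>n. a ^ n * (f (z / a ^ n) - f 0)) \<longlonglongrightarrow> D * z"
proof (cases "z = 0")
  case False
  have a: "a \<noteq> 0"
    using assms(2) by auto
  have "filterlim (\<lambda>n. z / a ^ n) (at 0) sequentially"
    using LIMSEQ_divide_power_zero [OF assms(2)] False a by (auto simp: filterlim_at)
  moreover have "((\<lambda>h. (f h - f 0) / h) \<longlongrightarrow> D) (at 0)"
    using assms(1) by (simp add: DERIV_def)
  ultimately have "(\<lambda>n. (f (z / a ^ n) - f 0) / (z / a ^ n)) \<longlonglongrightarrow> D"
    by (rule filterlim_compose [rotated])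
  then have "(\<lambda>n. (f (z / a ^ n) - f 0) / (z / a ^ n) * z) \<longlonglongrightarrow> D * z"
    by (intro tendsto_intros)
  moreover have "(f (z / a ^ n) - f 0) / (z / a ^ n) * z = a ^ n * (f (z / a ^ n) - f 0)" for n
    using False a by simp
  ultimately show ?thesis
    by simp
qed simp

text \<open>The first conjunct makes the formula meaningful: division and \<open>prodinf\<close> are
  total, so nonzero denominators and convergence are asserted separately.\<close>

theorem theorem1p3:
  fixes P :: "complex poly" and d :: nat and a b :: complex
    and f :: "complex \<Rightarrow> complex" and Pinv :: "nat \<Rightarrow> complex \<Rightarrow> complex"
  assumes "degree P = d" and "d \<ge> 2"
    and "b \<noteq> 0" and "poly P b = b"
    and "a = poly (pderiv P) b" and "norm a > 1"
    and "f holomorphic_on UNIV"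
    and "\<And>z. f (a * z) = poly P (f z)"
    and "f 0 = b" and "deriv f 0 = 1"
    and "inverse_branches P Pinv"
    and "principal_branch_at b (Pinv 0)"
    and hypothesis1: "\<And>w. (\<lambda>n. (Pinv 0 ^^ n) w) \<longlonglongrightarrow> b"
  shows "(\<forall>\<sigma> \<in> Sigma_seqs' d.
            (\<forall>n\<ge>2. poly (Qpoly P b) (branch_comp Pinv \<sigma> n b) \<noteq> 0) \<and>
            convergent_prod (\<lambda>n. g_factor P b Pinv \<sigma> (n + 2))) \<and>
         (\<forall>z. f z = b \<longrightarrow>
            z = 0 \<or> (\<exists>m. \<exists>\<sigma> \<in> Sigma_seqs' d. z = g_sol P b Pinv \<sigma> m))"
proof -
  have a: "a \<noteq> 0" "poly (pderiv P) b \<noteq> 0"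
    using assms(5,6) by auto
  have d: "degree P > 0"
    using assms(1,2) by simp
  have p0: "Pinv 0 b = b"
    using assms(12) by (simp add: principal_branch_at_def)
  have conv: "(\<forall>n\<ge>2. poly (Qpoly P b) (branch_comp Pinv \<sigma> n b) \<noteq> 0) \<and>
      convergent_prod (\<lambda>n. g_factor P b Pinv \<sigma> (n + 2))" if \<sigma>: "\<sigma> \<in> Sigma_seqs' d" for \<sigma>
  proof -
    \<comment> \<open>The shift by one drops the starting point b, so that no point of the orbit
      equals b.\<close>
    define w where "w n = branch_comp Pinv \<sigma> (Suc n) b" for n
    note orb = Sigma_seqs'_branch_comp [OF assms(11,4) a(2) p0 hypothesis1 _ d, of \<sigma>]
    have w: "poly P (w (Suc n)) = w n" "w n \<noteq> b" "w \<longlonglongrightarrow> b" for n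
      using orb(1) [of "Suc n"] orb(2) [of n] LIMSEQ_Suc [OF orb(3)] \<sigma> assms(1)
      unfolding w_def by simp_all
    have "poly (Qpoly P b) (branch_comp Pinv \<sigma> n b) \<noteq> 0" if n: "n \<ge> 2" for n
    proof -
      obtain k where k: "n = 2 + k"
        using le_Suc_ex [OF n] by blast
      have "poly (Qpoly P b) (w (Suc k)) \<noteq> 0"
        using backward_orbit_prod(1) [of P b w k, OF assms(4) w(1,2)] .
      then show ?thesis
        by (simp add: w_def k del: branch_comp.simps)
    qed
    moreover have "convergent_prod (\<lambda>n. g_factor P b Pinv \<sigma> (n + 2))"
      using backward_orbit_convergent_prod [of P b w, OF assms(4) w(1,3)] assms(5,6)
      by (simp add: g_factor_def w_def del: branch_comp.simps)
    ultimately show ?thesis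
      by blast
  qed
  have f': "(f has_field_derivative 1) (at 0)"
    using assms(10) holomorphic_derivI [OF assms(7) open_UNIV, of 0] by simp
  have sol: "\<exists>m. \<exists>\<sigma> \<in> Sigma_seqs' d. z = g_sol P b Pinv \<sigma> m" if z: "f z = b" "z \<noteq> 0" for z
  proof -
    define u where "u n = f (z / a ^ n)" for n
    have u: "poly P (u (Suc n)) = u n" for n
      using assms(8) [of "z / a ^ Suc n"] a by (simp add: u_def)
    have lim_u: "(\<lambda>n. a ^ n * (u n - b)) \<longlonglongrightarrow> z"
      using DERIV_scaled_LIMSEQ [OF f' assms(6), of z] assms(9) by (simp add: u_def)
    obtain m where m: "u m = b" "u (Suc m) \<noteq> b"
    proof -
      \<comment> \<open>Otherwise u would be constantly b, and the scaled differences, all 0, could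
        not tend to the nonzero z.\<close>
      have "\<not> (\<forall>m. u m = b \<longrightarrow> u (Suc m) = b)"
      proof
        assume step: "\<forall>m. u m = b \<longrightarrow> u (Suc m) = b"
        have "u n = b" for n
          by (induction n) (use z step in \<open>auto simp: u_def [of 0]\<close>)
        then show False
          using lim_u z(2) by (simp add: LIMSEQ_const_iff)
      qed
      then show ?thesis
        using that by blast
    qed
    have u_neq: "u (n + Suc m) \<noteq> b" for n
    proof (induction n)
      case 0
      then show ?case
        using m by simp
    next
      case (Suc n)
      then show ?case
        using u [of "n + Suc m"] assms(4) by auto
    qed
    define w where "w n = u (n + m)" for n
    have w: "poly P (w (Suc n)) = w n" for n
      using u by (simp add: w_def)
    have "u \<longlonglongrightarrow> b"
      unfolding u_def
      using isCont_tendsto_compose [OF DERIV_isCont [OF f'] LIMSEQ_divide_power_zero [OF assms(6)]]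
      by (simp add: assms(9))
    then have lim_w: "w \<longlonglongrightarrow> b"
      unfolding w_def by (rule LIMSEQ_ignore_initial_segment)
    have "w 0 = b" "w 1 \<noteq> b"
      using m by (simp_all add: w_def)
    then obtain \<sigma> where \<sigma>: "\<sigma> \<in> Sigma_seqs' (degree P)" "\<And>n. branch_comp Pinv \<sigma> n b = w n"
      using backward_orbit_itinerary [OF assms(11) d assms(4) a(2) assms(12), of w] w lim_w
      by blast
    let ?F = "\<lambda>n. g_factor P b Pinv \<sigma> (n + 2)"
    have w1: "Pinv (\<sigma> 1) b = w 1"
      using \<sigma>(2) [of 1] by simp
    have w_neq: "w (Suc n) \<noteq> b" for n
      using u_neq [of n] by (simp add: w_def)
    have "(w 1 - b) * (\<Prod>i<n. ?F i) = a ^ n * (w (Suc n) - b)" for n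
      using backward_orbit_prod(2) [of P b "\<lambda>n. w (Suc n)" a n, OF assms(4) w w_neq]
      by (simp add: g_factor_def \<sigma>(2) assms(5) del: branch_comp.simps)
    \<comment> \<open>The product starts from \<open>w 1 = u (Suc m)\<close>; the factor
      \<open>a ^ Suc m\<close> matches the power of a to the index of u, so the right side is a tail
      of the sequence in \<open>lim_u\<close>.\<close>
    then have "a ^ Suc m * ((w 1 - b) * (\<Prod>i<n. ?F i)) = a ^ (n + Suc m) * (u (n + Suc m) - b)" for n
      by (simp add: w_def power_add)
    moreover have "(\<lambda>n. a ^ (n + Suc m) * (u (n + Suc m) - b)) \<longlonglongrightarrow> z"
      using LIMSEQ_ignore_initial_segment [OF lim_u] .
    ultimately have "(\<lambda>n. a ^ Suc m * ((w 1 - b) * (\<Prod>i<n. ?F i))) \<longlonglongrightarrow> z"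
      by (simp only:)
    moreover have "(\<lambda>n. \<Prod>i<n. ?F i) \<longlonglongrightarrow> prodinf ?F"
      using convergent_prod_LIMSEQ [of ?F] conv \<sigma>(1) assms(1) by (simp add: LIMSEQ_lessThan_iff_atMost)
    then have "(\<lambda>n. a ^ Suc m * ((w 1 - b) * (\<Prod>i<n. ?F i))) \<longlonglongrightarrow> a ^ Suc m * ((w 1 - b) * prodinf ?F)"
      by (intro tendsto_intros)
    ultimately have "z = a ^ Suc m * ((w 1 - b) * prodinf ?F)"
      by (rule LIMSEQ_unique)
    then have "z = g_sol P b Pinv \<sigma> (Suc m)"
      unfolding g_sol_def w1 assms(5) by (simp add: mult.assoc)
    then show ?thesis
      using \<sigma>(1) assms(1) by blast
  qed
  show ?thesis
    using conv sol by blast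
qed

end
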